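(* Let $d\ge3$, $\nu_d<0$ and $k\in\{1,\dots,d-1\}$, and let $\mu_a^{(d)}$, $a\ge1$, be the processes defined in the context. a) For any $y_1,\dots,y_{d-k}\in Y$ with pairwise different orientations, $$\lim_{a\to\infty}\rho_{d-k}(y_1,\dots,y_{d-k};\mu_a^{(d)})=\frac kd.$$ b) Let $y_1,\dots,y_{2(d-k)}\in Y$ be distinct, such that the facets $y_1,\dots,y_{d-k}$ have pairwise different orientations, the facets $y_{d-k+1},\dots,y_{2(d-k)}$ have pairwise different orientations, and there are exactly $l$ common orientations of these two groups. Then $$\lim_{a\to\infty}\rho_{2(d-k)}(y_1,\dots,y_{2(d-k)};\mu_a^{(d)})=\frac{2k-d+l}d.$$ c) Let $y_1,\dots,y_{2(d-k)-1}\in Y$ be distinct, such that the facets $y_1,\dots,y_{d-k}$ have pairwise different orientations, the facets $y_{d-k+1},\dots,y_{2(d-k)-1},y_1$ have pairwise different orientations, $y_1$ has orientation $e_1$, and these two groups have exactly $l$ common orientations $e_2,\dots,e_{l+1}$ not counting the orientation $e_1$ of $y_1$. Then $$\lim_{a\to\infty}\rho_{2(d-k)-1}(y_1,\dots,y_{2(d-k)-1};\mu_a^{(d)})=\frac{2k-d+l+1}d.$$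
   Context: Let $b>0$, let $\chi:[0,b]^d\to[0,\infty)$ be bounded and measurable with $T=\int_{[0,b]^d}\chi(z)\,\mathrm dz>0$, let $e_1,\dots,e_d$ be the canonical unit vectors of $\mathbb R^d$, and let $Y=[0,b]^d\times\{2b\}\times\{e_1,\dots,e_d\}$. A point $y=(z,2b,e_i)\in Y$ is identified with the facet $\{s\in\mathbb R^d:\ s_i=z_i,\ \max_j|z_j-s_j|\le b\}$; $e_i$ is its orientation. The measure $\lambda$ on $Y$ is $\lambda(\mathrm d(z,r,\phi))=\chi(z)\,\mathrm dz\,\delta_{2b}(\mathrm dr)\,V(\mathrm d\phi)$ with $V$ uniform on $\{e_1,\dots,e_d\}$. For $a\ge1$, $\eta_a$ is the Poisson process on $Y$ with intensity measure $a\lambda$. For a finite configuration $\mathbf x$ of points of $Y$, $G_j(\mathbf x)=\frac1{j!}\sum\mathbb H^{d-j}(\bigcap_{i=1}^jx_i)$, the sum being over ordered $j$-tuples of distinct points of $\mathbf x$ whose hyperplanes are in general position (i.e. with pairwise different orientations); $\mathbb H^i$ is $i$-dimensional Hausdorff measure. $\mu_a^{(d)}$ is the point process with density $p_a(\mathbf x)=c_a\exp(\nu_dG_d(\mathbf x))$ with respect to the distribution of $\eta_a$, $c_a$ being the normalizing constant. Its correlation functions are $\rho_n(y_1,\dots,y_n;\mu_a^{(d)})=\mathbb E[p_a(\eta_a\cup\{y_1,\dots,y_n\})]$ for distinct $y_1,\dots,y_n\in Y$. *)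

theory Defs
  imports "HOL-Probability.Probability"
begin

text \<open>
  Hausdorff measure of integer dimension, normalized to agree with Lebesgue measure. In dimension 0
  the convention \<open>0 ^ 0 = 1\<close> together with the special treatment of the empty set
  yields the counting measure. Covering sets have to be bounded, as \<^const>\<open>diameter\<close> carries
  no information about unbounded sets.
\<close>

definition hausdorff_measure :: "nat \<Rightarrow> 'a::metric_space set \<Rightarrow> ennreal" where
  "hausdorff_measure n A =
     (SUP \<delta>\<in>{0::real<..}.
        INF U\<in>{U :: nat \<Rightarrow> 'a set. A \<subseteq> (\<Union>i. U i) \<and> (\<forall>i. bounded (U i) \<and> diameter (U i) \<le> \<delta>)}.
          (\<Sum>i. if U i = {} then 0
               else ennreal (unit_ball_vol (real n) * (diameter (U i) / 2) ^ n)))"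

definition configurations :: "'a measure \<Rightarrow> 'a set set" where
  "configurations M = {x. finite x \<and> x \<subseteq> space M}"

definition config_space :: "'a measure \<Rightarrow> 'a set measure" where
  "config_space M =
     sigma (configurations M)
       {{x \<in> configurations M. card (x \<inter> B) = n} | B n. B \<in> sets M}"

text \<open>
  For a finite intensity measure \<open>\<Lambda>\<close> without atoms the Poisson process is almost surely finite
  and simple, so it is modelled as a random finite set rather than as a random counting measure.
  The counts are required to be Poisson distributed and, on disjoint sets, independent.
\<close>

definition poisson_process :: "'w measure \<Rightarrow> 'a measure \<Rightarrow> ('w \<Rightarrow> 'a set) \<Rightarrow> bool" where
  "poisson_process W \<Lambda> \<eta> \<longleftrightarrow>
     prob_space W \<and>
     \<eta> \<in> measurable W (config_space \<Lambda>) \<and>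
     (\<forall>B\<in>sets \<Lambda>. \<forall>n. measure W {\<omega> \<in> space W. card (\<eta> \<omega> \<inter> B) = n}
        = measure \<Lambda> B ^ n / fact n * exp (- measure \<Lambda> B)) \<and>
     (\<forall>(B :: nat \<Rightarrow> 'a set) m.
        (\<forall>i<m. B i \<in> sets \<Lambda>) \<and> disjoint_family_on B {..<m} \<longrightarrow>
        prob_space.indep_vars W (\<lambda>_. count_space UNIV) (\<lambda>i \<omega>. card (\<eta> \<omega> \<inter> B i)) {..<m})"

type_synonym 'd facet_param = "(real^'d) \<times> real \<times> (real^'d)"

definition cube :: "real \<Rightarrow> (real^'d) set" where
  "cube b = {z. \<forall>i. 0 \<le> z $ i \<and> z $ i \<le> b}"

definition unit_vectors :: "(real^'d) set" where
  "unit_vectors = range (\<lambda>i. axis i 1)"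

definition facet_params :: "real \<Rightarrow> 'd::finite facet_param set" where
  "facet_params b = cube b \<times> {2 * b} \<times> unit_vectors"

definition orientation :: "'d::finite facet_param \<Rightarrow> real^'d" where
  "orientation y = snd (snd y)"

text \<open>For \<open>r = 2 b\<close> and \<open>\<phi> = axis i 1\<close> the conditions read \<open>s $ i = z $ i\<close> and
  \<open>max\<^sub>j \<bar>z $ j - s $ j\<bar> \<le> b\<close>.\<close>

fun facet :: "'d::finite facet_param \<Rightarrow> (real^'d) set" where
  "facet (z, r, \<phi>) = {s. s \<bullet> \<phi> = z \<bullet> \<phi> \<and> (\<forall>j. \<bar>z $ j - s $ j\<bar> \<le> r / 2)}"

text \<open>The underlying space of this measure is exactly \<open>facet_params b\<close>.\<close>

definition facet_measure :: "real \<Rightarrow> (real^'d \<Rightarrow> real) \<Rightarrow> 'd::finite facet_param measure" where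
  "facet_measure b h =
     density (restrict_space lborel (cube b)) (\<lambda>z. ennreal (h z)) \<Otimes>\<^sub>M
     (return (count_space {2 * b}) (2 * b) \<Otimes>\<^sub>M uniform_count_measure unit_vectors)"

text \<open>Tuples are lists. Hyperplanes of facets are in general position iff their orientations are
  pairwise different. The Hausdorff measures involved are finite, because the intersections are
  bounded parts of \<open>(d - j)\<close>-dimensional affine subspaces.\<close>

definition facet_G :: "nat \<Rightarrow> 'd::finite facet_param set \<Rightarrow> real" where
  "facet_G j x =
     (\<Sum>ys | length ys = j \<and> distinct ys \<and> set ys \<subseteq> x \<and> distinct (map orientation ys).
        enn2real (hausdorff_measure (CARD('d) - j) (\<Inter>y\<in>set ys. facet y))) / fact j"

definition normalizing_constant ::
    "'w measure \<Rightarrow> ('w \<Rightarrow> 'd::finite facet_param set) \<Rightarrow> real \<Rightarrow> real" where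
  "normalizing_constant W \<eta> \<nu> = 1 / (LINT \<omega>|W. exp (\<nu> * facet_G CARD('d) (\<eta> \<omega>)))"

definition facet_density ::
    "'w measure \<Rightarrow> ('w \<Rightarrow> 'd::finite facet_param set) \<Rightarrow> real \<Rightarrow> 'd facet_param set \<Rightarrow> real" where
  "facet_density W \<eta> \<nu> x = normalizing_constant W \<eta> \<nu> * exp (\<nu> * facet_G CARD('d) x)"

text \<open>The \<open>n\<close>-th correlation function at the points \<open>y 1, \<dots>, y n\<close> of the point process that has
  density \<open>facet_density W \<eta> \<nu>\<close> with respect to the distribution of \<open>\<eta>\<close>.\<close>

definition correlation ::
    "'w measure \<Rightarrow> ('w \<Rightarrow> 'd::finite facet_param set) \<Rightarrow> real \<Rightarrow> nat \<Rightarrow> (nat \<Rightarrow> 'd facet_param) \<Rightarrow> real"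
  where
  "correlation W \<eta> \<nu> n y = (LINT \<omega>|W. facet_density W \<eta> \<nu> (\<eta> \<omega> \<union> y ` {1..n}))"

end

theory Submission
  imports Defs "HOL-Real_Asymp.Real_Asymp"
begin

text \<open>
  Any \<open>d\<close> facets with pairwise different orientations meet in exactly one point, so
  \<open>G\<^sub>d\<close> is the product over \<open>i\<close> of the numbers of facets with orientation
  \<open>e\<^sub>i\<close>. For the Poisson process these numbers \<open>N\<^sub>i\<close> are independent with
  parameter \<open>\<mu> = a T / d\<close>, and the correlation function at points of which \<open>m\<^sub>i\<close> have
  orientation \<open>e\<^sub>i\<close> is the quotient of \<open>E exp (\<nu> \<Prod>\<^sub>i (N\<^sub>i + m\<^sub>i))\<close> by the
  same expectation with all \<open>m\<^sub>i = 0\<close>. Since \<open>\<nu> < 0\<close>, the dominant outcomes are those with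
  a vanishing factor: some \<open>N\<^sub>i = 0\<close> with \<open>m\<^sub>i = 0\<close>, which has probability asymptotic to
  \<open>z exp (- \<mu>)\<close>, where \<open>z\<close> is the number of orientations with \<open>m\<^sub>i = 0\<close>; all other outcomes
  contribute \<open>o(exp (- \<mu>))\<close>. The limit is therefore \<open>z / d\<close>, and in each of the three cases
  \<open>z\<close> is obtained by counting the orientations that occur.
\<close>

section \<open>The functional \<open>facet_G CARD('d)\<close> as a product of counts\<close>

text \<open>In dimension 0 every nonempty covering set has weight 1 whatever its diameter, because
  \<open>0 ^ 0 = 1\<close>. The singleton itself is thus an optimal cover for each \<delta>.\<close>

lemma hausdorff_measure_0_singleton: "hausdorff_measure 0 {s} = 1"
proof -
  let ?f = "\<lambda>(U :: nat \<Rightarrow> 'a set) i. if U i = {} then 0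
    else ennreal (unit_ball_vol (real 0) * (diameter (U i) / 2) ^ 0)"
  let ?U = "\<lambda>\<delta>. {U :: nat \<Rightarrow> 'a set. {s} \<subseteq> (\<Union>i. U i) \<and> (\<forall>i. bounded (U i) \<and> diameter (U i) \<le> \<delta>)}"
  have inf1: "(INF U\<in>?U \<delta>. (\<Sum>i. ?f U i)) = 1" if "\<delta> > 0" for \<delta> :: real
  proof (rule antisym)
    let ?V = "\<lambda>i::nat. if i = 0 then {s} else {}"
    have V: "?V \<in> ?U \<delta>"
      using that by auto
    have "(\<Sum>i. ?f ?V i) = (\<Sum>i\<in>{0}. ?f ?V i)"
      by (rule suminf_finite) auto
    then show "(INF U\<in>?U \<delta>. (\<Sum>i. ?f U i)) \<le> 1"
      by (intro INF_lower2[OF V]) simp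
    show "1 \<le> (INF U\<in>?U \<delta>. (\<Sum>i. ?f U i))"
    proof (rule INF_greatest)
      fix U assume "U \<in> ?U \<delta>"
      then obtain i where "s \<in> U i"
        by blast
      then have "1 \<le> (\<Sum>j\<in>{i}. ?f U j)"
        by auto
      also have "\<dots> \<le> (\<Sum>j. ?f U j)"
        by (rule sum_le_suminf) auto
      finally show "1 \<le> (\<Sum>j. ?f U j)" .
    qed
  qed
  have "hausdorff_measure 0 {s} = (SUP \<delta>\<in>{0::real<..}. INF U\<in>?U \<delta>. (\<Sum>i. ?f U i))"
    unfolding hausdorff_measure_def by simp
  also have "\<dots> = (SUP \<delta>\<in>{0::real<..}. 1)"
    by (intro SUP_cong) (auto simp only: inf1 greaterThan_iff)
  also have "\<dots> = 1"
    by (subst SUP_const) auto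
  finally show ?thesis .
qed

lemma facet_params_memD:
  assumes "y \<in> facet_params b"
  obtains z i where "y = (z, 2 * b, axis i 1)" "z \<in> cube b"
  using assms unfolding facet_params_def unit_vectors_def by auto

lemma facet_axis:
  fixes z :: "real^'d::finite"
  shows "facet (z, r, axis i 1) = {s. s $ i = z $ i \<and> (\<forall>j. \<bar>z $ j - s $ j\<bar> \<le> r / 2)}"
  by (simp add: inner_axis)

text \<open>The side length \<open>2 b\<close> guarantees that each facet reaches across the whole cube, so
  that \<open>d\<close> facets with different orientations always meet.\<close>
lemma Inter_facets_eq_singleton:
  fixes f :: "'d::finite \<Rightarrow> 'd facet_param"
  assumes "\<And>i. f i \<in> facet_params b" "\<And>i. orientation (f i) = axis i 1"
  shows "(\<Inter>i. facet (f i)) = {\<chi> i. fst (f i) $ i}"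
proof -
  have f: "f i = (fst (f i), 2 * b, axis i 1)" "fst (f i) \<in> cube b" for i
    using assms(1)[of i] assms(2)[of i] by (auto elim!: facet_params_memD simp: orientation_def)
  have F: "facet (f i) =
    {s. s $ i = fst (f i) $ i \<and> (\<forall>j. \<bar>fst (f i) $ j - s $ j\<bar> \<le> b)}" for i
    by (subst f(1)) (simp only: facet_axis, simp)
  have "\<bar>fst (f i) $ j - fst (f j) $ j\<bar> \<le> b" for i j
    using f(2)[of i] f(2)[of j] unfolding cube_def by (smt (verit) mem_Collect_eq)
  then show ?thesis
    unfolding F by (auto simp: vec_eq_iff)
qed

lemma axis_1_eq_iff [simp]: "axis i (1::real) = axis j 1 \<longleftrightarrow> i = j"
  by (simp add: axis_eq_axis)

text \<open>Such a list amounts to a choice \<open>f\<close> of one facet per orientation together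
  with an order \<open>\<sigma>\<close> of the orientations, through
  \<open>ys = map f \<sigma>\<close>. The factor \<open>fact CARD('d)\<close> counts the orders and
  later cancels the division in \<open>facet_G\<close>.\<close>

lemma card_lists_orientations:
  fixes x :: "'d::finite facet_param set"
  assumes x: "finite x" "x \<subseteq> facet_params b"
  defines "L \<equiv> {ys. length ys = CARD('d) \<and> distinct ys \<and> set ys \<subseteq> x \<and> distinct (map orientation ys)}"
  shows "card L = fact CARD('d) * (\<Prod>i\<in>UNIV. card {y\<in>x. orientation y = axis i 1})"
    and "ys \<in> L \<Longrightarrow> \<exists>f. set ys = range f \<and> (\<forall>i. f i \<in> facet_params b \<and> orientation (f i) = axis i 1)"
proof -
  define P where "P = Pi\<^sub>E UNIV (\<lambda>i. {y\<in>x. orientation y = axis i 1})"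
  define S where "S = permutations_of_set (UNIV :: 'd set)"
  have sur: "\<exists>f\<in>P. \<exists>\<sigma>\<in>S. ys = map f \<sigma>" if ys: "ys \<in> L" for ys
  proof -
    have "\<exists>i. orientation y = axis i 1" if "y \<in> set ys" for y
    proof -
      have "y \<in> facet_params b" using that ys x by (auto simp: L_def)
      then show ?thesis by (elim facet_params_memD) (auto simp: orientation_def)
    qed
    then obtain g where g: "\<And>y. y \<in> set ys \<Longrightarrow> orientation y = axis (g y) 1"
      by metis
    have "inj_on orientation (set ys)"
      using ys by (simp add: L_def distinct_map)
    then have inj: "inj_on g (set ys)"
      using g by (auto simp: inj_on_def)
    have dist: "distinct (map g ys)"
      using ys inj by (simp add: L_def distinct_map)
    \<comment> \<open>As many distinct indices as there are orientations exhaust all of them, so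
      \<open>g\<close> can be inverted at every index.\<close>
    have "card (set (map g ys)) = CARD('d)"
      using distinct_card[OF dist] ys by (simp add: L_def)
    then have un: "set (map g ys) = UNIV"
      by (intro card_subset_eq) auto
    define f where "f = inv_into (set ys) g"
    have f: "f i \<in> set ys" "g (f i) = i" for i
      using un by (auto simp: f_def intro!: inv_into_into f_inv_into_f)
    have "f i \<in> x \<and> orientation (f i) = axis i 1" for i
      using f[of i] g[of "f i"] ys by (auto simp: L_def)
    then have "f \<in> P" by (auto simp: P_def PiE_def extensional_def)
    moreover have "map g ys \<in> S"
      using dist un unfolding S_def permutations_of_set_def by blast
    moreover have "map f (map g ys) = map (\<lambda>y. y) ys"
      unfolding map_map by (rule map_cong) (auto simp: f_def inj)
    ultimately show ?thesis by (intro bexI[of _ f] bexI[of _ "map g ys"]) auto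
  qed
  have P: "f i \<in> x" "orientation (f i) = axis i 1" if "f \<in> P" for f i
    using that by (auto simp: P_def PiE_def Pi_def)
  have S: "set \<sigma> = UNIV" "distinct \<sigma>" "length \<sigma> = CARD('d)" if "\<sigma> \<in> S" for \<sigma>
    using permutations_of_setD[OF that[unfolded S_def]] by (auto simp: distinct_card[symmetric])
  have "bij_betw (\<lambda>(f, \<sigma>). map f \<sigma>) (P \<times> S) L"
  proof (rule bij_betwI')
    fix p q assume pq: "p \<in> P \<times> S" "q \<in> P \<times> S"
    obtain f \<sigma> f' \<sigma>' where [simp]: "p = (f, \<sigma>)" "q = (f', \<sigma>')"
      by (cases p, cases q)
    have "p = q" if eq: "map f \<sigma> = map f' \<sigma>'"
    proof -
      \<comment> \<open>Orientations recover \<open>\<sigma>\<close> from the list; as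
        \<open>\<sigma>\<close> runs through all of \<open>UNIV\<close>, the values of
        \<open>f\<close> are then determined too.\<close>
      have "map orientation (map f \<sigma>) = map (\<lambda>i. axis i 1) \<sigma>"
        "map orientation (map f' \<sigma>') = map (\<lambda>i. axis i 1) \<sigma>'"
        using pq P by auto
      then have "map (\<lambda>i. axis i (1::real)) \<sigma> = map (\<lambda>i. axis i 1) \<sigma>'"
        using eq by simp
      then have "\<sigma> = \<sigma>'"
        by (subst (asm) inj_map_eq_map) (auto simp: inj_def)
      moreover have "f i = f' i" for i
        using eq pq S(1)[of \<sigma>] \<open>\<sigma> = \<sigma>'\<close> by auto
      ultimately show ?thesis by auto
    qed
    then show "((case p of (f, \<sigma>) \<Rightarrow> map f \<sigma>) = (case q of (f, \<sigma>) \<Rightarrow> map f \<sigma>)) = (p = q)"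
      by auto
  next
    fix p assume p: "p \<in> P \<times> S"
    obtain f \<sigma> where [simp]: "p = (f, \<sigma>)" by (cases p)
    have "inj f"
      using P[of f] p by (metis SigmaE axis_1_eq_iff injI prod.inject \<open>p = (f, \<sigma>)\<close>)
    moreover have "inj_on orientation (range f)"
      using p P(2)[of f] by (auto simp: inj_on_def)
    ultimately show "(case p of (f, \<sigma>) \<Rightarrow> map f \<sigma>) \<in> L"
      using p S[of \<sigma>] P(1)[of f] unfolding L_def by (auto simp: distinct_map intro: inj_on_subset)
  next
    fix ys assume "ys \<in> L"
    then show "\<exists>p\<in>P \<times> S. ys = (case p of (f, \<sigma>) \<Rightarrow> map f \<sigma>)"
      using sur by fastforce
  qed
  then have "card L = card P * card S"
    by (metis bij_betw_same_card card_cartesian_product)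
  then show "card L = fact CARD('d) * (\<Prod>i\<in>UNIV. card {y\<in>x. orientation y = axis i 1})"
    by (simp add: P_def S_def card_PiE)
  show "\<exists>f. set ys = range f \<and> (\<forall>i. f i \<in> facet_params b \<and> orientation (f i) = axis i 1)"
    if "ys \<in> L"
    using sur[OF that] P x S by (metis list.set_map subsetD)
qed

text \<open>Each term is the counting measure of a single intersection point, so the sum only counts
  lists.\<close>

lemma facet_G_top_eq_prod:
  fixes x :: "'d::finite facet_param set"
  assumes x: "finite x" "x \<subseteq> facet_params b"
  shows "facet_G CARD('d) x = real (\<Prod>i\<in>UNIV. card {y\<in>x. orientation y = axis i 1})"
proof -
  let ?L = "{ys. length ys = CARD('d) \<and> distinct ys \<and> set ys \<subseteq> x \<and> distinct (map orientation ys)}"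
  have "enn2real (hausdorff_measure (CARD('d) - CARD('d)) (\<Inter>y\<in>set ys. facet y)) = 1"
    if "ys \<in> ?L" for ys
  proof -
    obtain f where f: "set ys = range f"
      "\<And>i. f i \<in> facet_params b" "\<And>i. orientation (f i) = axis i 1"
      using card_lists_orientations(2)[OF x \<open>ys \<in> ?L\<close>] by blast
    then show ?thesis
      using Inter_facets_eq_singleton[OF f(2,3)] by (simp add: hausdorff_measure_0_singleton)
  qed
  then have "facet_G CARD('d) x = (\<Sum>ys\<in>?L. 1) / fact CARD('d)"
    unfolding facet_G_def by (intro arg_cong2[where f = "(/)"] sum.cong) auto
  then show ?thesis
    by (simp add: card_lists_orientations(1)[OF x])
qed

section \<open>Expectations of exponentials of products of Poisson variables\<close>

text \<open>The probability generating function is needed at 0, where \<open>0 ^ 0 = 1\<close> turns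
  it into the probability of a zero count, and at \<open>1/4\<close> and \<open>c ^ J\<close> for
  the error terms.\<close>

lemma (in prob_space) expectation_power_poisson:
  fixes X :: "'a \<Rightarrow> nat"
  assumes X [measurable]: "X \<in> measurable M (count_space UNIV)"
    and prob: "\<And>n. prob {\<omega> \<in> space M. X \<omega> = n} = \<mu> ^ n / fact n * exp (- \<mu>)"
    and \<mu>: "\<mu> > 0" and t: "t \<ge> 0"
  shows "integrable M (\<lambda>\<omega>. t ^ X \<omega>)" and "expectation (\<lambda>\<omega>. t ^ X \<omega>) = exp (- \<mu> * (1 - t))"
proof -
  have "distr M (count_space UNIV) X = measure_pmf (poisson_pmf \<mu>)"
  proof (rule measure_eqI_countable[of _ UNIV])
    fix n :: nat
    have "emeasure (distr M (count_space UNIV) X) {n} = emeasure M {\<omega> \<in> space M. X \<omega> = n}"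
      by (subst emeasure_distr) (auto intro!: arg_cong[where f = "emeasure M"])
    then show "emeasure (distr M (count_space UNIV) X) {n} = emeasure (measure_pmf (poisson_pmf \<mu>)) {n}"
      using \<mu> by (simp add: emeasure_eq_measure prob emeasure_pmf_single)
  qed auto
  then have distr: "distr M (count_space UNIV) X = density (count_space UNIV) (\<lambda>n. ennreal (pmf (poisson_pmf \<mu>) n))"
    by (simp add: measure_pmf_eq_density)
  have sums: "(\<lambda>n. pmf (poisson_pmf \<mu>) n * t ^ n) sums (exp (- \<mu>) * exp (\<mu> * t))"
  proof -
    have "(\<lambda>n. exp (- \<mu>) * ((\<mu> * t) ^ n /\<^sub>R fact n)) sums (exp (- \<mu>) * exp (\<mu> * t))"
      by (intro sums_mult exp_converges)
    then show ?thesis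
      using \<mu> by (simp add: power_mult_distrib field_simps scaleR_conv_of_real)
  qed
  then have int: "integrable (count_space UNIV) (\<lambda>n. pmf (poisson_pmf \<mu>) n * t ^ n)"
    using t by (auto simp: integrable_count_space_nat_iff abs_mult dest: sums_summable)
  show "integrable M (\<lambda>\<omega>. t ^ X \<omega>)"
    using int by (subst integrable_distr_eq[OF X, symmetric])
      (auto simp: distr integrable_density)
  have "expectation (\<lambda>\<omega>. t ^ X \<omega>) = integral\<^sup>L (distr M (count_space UNIV) X) (\<lambda>n. t ^ n)"
    by (subst integral_distr) auto
  also have "\<dots> = (\<integral>n. pmf (poisson_pmf \<mu>) n * t ^ n \<partial>count_space UNIV)"
    by (auto simp: distr integral_density)
  also have "\<dots> = exp (- \<mu>) * exp (\<mu> * t)"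
    using sums_integral_count_space_nat[OF int] sums by (rule sums_unique2)
  finally show "expectation (\<lambda>\<omega>. t ^ X \<omega>) = exp (- \<mu> * (1 - t))"
    by (simp add: exp_add[symmetric] algebra_simps)
qed

text \<open>If one of the two factors is at least \<open>2 J\<close>, the other one still supplies the power
  \<open>J (n + 1)\<close>; otherwise both are small, which the Chernoff term takes care of.\<close>
lemma power_mult_le:
  fixes c :: real and J n n' m m' :: nat
  assumes c: "0 < c" "c < 1" and pos: "n + m > 0" "n' + m' > 0"
  shows "c ^ ((n + m) * (n' + m')) \<le>
    256 ^ J * ((1/4) ^ n * (1/4) ^ n') + c ^ J * ((c ^ J) ^ n + (c ^ J) ^ n')"
proof -
  have large: "c ^ (k * k') \<le> c ^ J * (c ^ J) ^ l"
    if "k \<ge> 2 * J" "k' > 0" "l \<le> k'" for k k' l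
  proof -
    \<comment> \<open>Half of \<open>2 * J * k'\<close> covers \<open>J\<close> since
      \<open>k' > 0\<close>, the other half covers \<open>J * l\<close> since
      \<open>l \<le> k'\<close>.\<close>
    have "J + J * l \<le> J * k' + J * k'"
      using that by (intro add_mono) auto
    also have "\<dots> = 2 * J * k'"
      by simp
    also have "\<dots> \<le> k * k'"
      using that by (intro mult_right_mono) auto
    finally show ?thesis
      using c by (simp add: power_mult[symmetric] power_add[symmetric] power_decreasing)
  qed
  consider "n < 2 * J" "n' < 2 * J" | "n + m \<ge> 2 * J" | "n' + m' \<ge> 2 * J"
    by linarith
  then show ?thesis
  proof cases
    case 1
    have "c ^ ((n + m) * (n' + m')) \<le> 1"
      using c by (simp add: power_le_one)
    \<comment> \<open>The constant is \<open>256 = 4 ^ 4\<close>: its power compensates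
      \<open>(1/4) ^ (n + n')\<close> as long as \<open>n + n' \<le> 4 * J\<close>.\<close>
    also have "1 = (256 * (1/4 :: real) ^ 4) ^ J"
      by (simp add: power_divide)
    also have "\<dots> = 256 ^ J * (1/4) ^ (4 * J)"
      by (simp only: power_mult power_mult_distrib)
    also have "\<dots> \<le> 256 ^ J * (1/4) ^ (n + n')"
      using 1 by (intro mult_left_mono power_decreasing) auto
    finally show ?thesis
      using c by (simp add: power_add add_increasing2)
  next
    case 2
    show ?thesis
      using large[OF 2 pos(2), of n'] c by (simp add: distrib_left add_increasing)
  next
    case 3
    have "c ^ ((n + m) * (n' + m')) \<le> c ^ J * (c ^ J) ^ n"
      unfolding mult.commute[of "n + m"] by (rule large[OF 3 pos(1)]) simp
    then show ?thesis
      using c by (simp add: distrib_left add_increasing add_increasing2)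
  qed
qed

text \<open>\<open>A\<close> is exactly the probability that some count with \<open>m i = 0\<close>
  vanishes, and then the integrand is 1. On the complement all factors are positive, and the two
  with indices \<open>p\<close> and \<open>r\<close> already make the integrand small.
  \<open>J\<close> stays free, to be chosen later in terms of \<mu>.\<close>

lemma (in prob_space) expectation_power_prod_poisson_bounds:
  fixes N :: "'i \<Rightarrow> 'a \<Rightarrow> nat" and m :: "'i \<Rightarrow> nat" and c :: real
  assumes I: "finite I" "p \<in> I" "r \<in> I" "p \<noteq> r"
    and indep: "indep_vars (\<lambda>_. count_space UNIV) N I"
    and prob: "\<And>i n. i \<in> I \<Longrightarrow> prob {\<omega> \<in> space M. N i \<omega> = n} = \<mu> ^ n / fact n * exp (- \<mu>)"
    and \<mu>: "\<mu> > 0" and c: "0 < c" "c < 1"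
  defines "A \<equiv> 1 - (1 - exp (- \<mu>)) ^ card {i\<in>I. m i = 0}"
    and "E \<equiv> expectation (\<lambda>\<omega>. c ^ (\<Prod>i\<in>I. N i \<omega> + m i))"
  shows "A \<le> E" and "E \<le> A + (256 ^ J * exp (- 3 / 2 * \<mu>) + c ^ J * (2 * exp (- \<mu> * (1 - c ^ J))))"
proof -
  define Z where "Z = {i\<in>I. m i = 0}"
  have Z: "finite Z" "Z \<subseteq> I"
    using I by (auto simp: Z_def)
  have rv [measurable]: "N i \<in> measurable M (count_space UNIV)" if "i \<in> I" for i
    using indep that by (auto simp: indep_vars_def2)
  have gen: "integrable M (\<lambda>\<omega>. t ^ N i \<omega>)"
    "expectation (\<lambda>\<omega>. t ^ N i \<omega>) = exp (- \<mu> * (1 - t))" if "i \<in> I" "t \<ge> 0" for i t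
    using expectation_power_poisson[OF rv prob \<mu>] that by auto
  define f where "f \<omega> = c ^ (\<Prod>i\<in>I. N i \<omega> + m i)" for \<omega>
  \<comment> \<open>\<open>0 ^ N i \<omega>\<close> is the indicator of a zero count, so
    \<open>g\<close> is the indicator of the event that some count in \<open>Z\<close> vanishes; the
    product form lets independence evaluate its expectation.\<close>
  define g where "g \<omega> = 1 - (\<Prod>i\<in>Z. 1 - (0::real) ^ N i \<omega>)" for \<omega>
  define B where "B \<omega> = 256 ^ J * ((1/4) ^ N p \<omega> * (1/4) ^ N r \<omega>)
    + c ^ J * ((c ^ J) ^ N p \<omega> + (c ^ J) ^ N r \<omega>)" for \<omega>
  have f_meas: "f \<in> borel_measurable M"
  proof -
    have "(\<lambda>\<omega>. c powr (\<Prod>i\<in>I. real (N i \<omega> + m i))) \<in> borel_measurable M"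
      by measurable
    also have "(\<lambda>\<omega>. c powr (\<Prod>i\<in>I. real (N i \<omega> + m i))) = f"
      using c by (simp add: fun_eq_iff f_def powr_realpow[symmetric])
    finally show ?thesis .
  qed
  have f_int: "integrable M f"
    by (rule integrable_const_bound[where B = 1])
      (use c f_meas in \<open>auto simp: f_def power_le_one\<close>)
  have indepZ: "indep_vars (\<lambda>_. borel) (\<lambda>i \<omega>. 1 - (0::real) ^ N i \<omega>) Z"
    by (rule indep_vars_compose2[OF indep_vars_subset[OF indep Z(2)]]) auto
  have intZ: "integrable M (\<lambda>\<omega>. 1 - (0::real) ^ N i \<omega>)" if "i \<in> Z" for i
    using gen(1)[of i 0] that Z by auto
  have g: "integrable M g" "expectation g = A"
  proof -
    show "integrable M g"
      unfolding g_def using indep_vars_integrable[OF Z(1) indepZ intZ] by auto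
    have "expectation g = 1 - (\<Prod>i\<in>Z. expectation (\<lambda>\<omega>. 1 - (0::real) ^ N i \<omega>))"
      unfolding g_def using indep_vars_integrable[OF Z(1) indepZ intZ]
      by (simp add: indep_vars_lebesgue_integral[OF Z(1) indepZ intZ] prob_space)
    also have "(\<Prod>i\<in>Z. expectation (\<lambda>\<omega>. 1 - (0::real) ^ N i \<omega>)) = (\<Prod>i\<in>Z. 1 - exp (- \<mu>))"
      using gen[of _ 0] Z by (intro prod.cong) (auto simp: prob_space)
    finally show "expectation g = A"
      by (simp add: A_def Z_def)
  qed
  have pr: "integrable M (\<lambda>\<omega>. (1/4::real) ^ N p \<omega> * (1/4) ^ N r \<omega>)"
    "expectation (\<lambda>\<omega>. (1/4::real) ^ N p \<omega> * (1/4) ^ N r \<omega>) = exp (- 3 / 2 * \<mu>)"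
  proof -
    have ind: "indep_vars (\<lambda>_. borel) (\<lambda>i \<omega>. (1/4::real) ^ N i \<omega>) {p, r}"
      by (rule indep_vars_compose2[OF indep_vars_subset[OF indep]]) (use I in auto)
    have int: "integrable M (\<lambda>\<omega>. (1/4::real) ^ N i \<omega>)" if "i \<in> {p, r}" for i
      using that I gen(1)[of i "1/4"] by auto
    show "integrable M (\<lambda>\<omega>. (1/4::real) ^ N p \<omega> * (1/4) ^ N r \<omega>)"
      using indep_vars_integrable[OF _ ind int] I by simp
    \<comment> \<open>Each factor has expectation \<open>exp (- 3 / 4 * \<mu>)\<close>. The base
      \<open>1/4\<close> is small enough for the total rate \<open>3 / 2\<close> to exceed the rate
      1 of the main term.\<close>
    show "expectation (\<lambda>\<omega>. (1/4::real) ^ N p \<omega> * (1/4) ^ N r \<omega>) = exp (- 3 / 2 * \<mu>)"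
      using indep_vars_lebesgue_integral[OF _ ind int] I
      by (simp add: gen(2)[of _ "1/4"] exp_add[symmetric])
  qed
  have cJ: "0 \<le> c ^ J"
    using c by simp
  have B: "integrable M B"
    "expectation B = 256 ^ J * exp (- 3 / 2 * \<mu>) + c ^ J * (2 * exp (- \<mu> * (1 - c ^ J)))"
    unfolding B_def using pr gen[OF I(2) cJ] gen[OF I(3) cJ] by (auto simp: pr(2))
  have bounds: "g \<omega> \<le> f \<omega> \<and> f \<omega> \<le> g \<omega> + B \<omega>" for \<omega>
  proof (cases "\<exists>i\<in>Z. N i \<omega> = 0")
    case True
    then have "(\<Prod>i\<in>Z. 1 - (0::real) ^ N i \<omega>) = 0" "(\<Prod>i\<in>I. N i \<omega> + m i) = 0"
      using Z I by (auto simp: Z_def)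
    then have "g \<omega> = 1" "f \<omega> = 1"
      by (simp_all only: f_def g_def power_0 diff_zero)
    moreover have "B \<omega> \<ge> 0"
      using c by (auto simp: B_def)
    ultimately show ?thesis by auto
  next
    case False
    then have "(\<Prod>i\<in>Z. 1 - (0::real) ^ N i \<omega>) = (\<Prod>i\<in>Z. 1)"
      by (intro prod.cong) (auto simp: power_0_left)
    then have g0: "g \<omega> = 0"
      by (simp add: g_def)
    have pos: "N i \<omega> + m i > 0" if "i \<in> I" for i
      using False that by (auto simp: Z_def)
    \<comment> \<open>The remaining factors are at least 1; dropping them lowers the exponent at
      most, which can only raise the power as \<open>c < 1\<close>.\<close>
    have "(\<Prod>i\<in>I. N i \<omega> + m i) = (N p \<omega> + m p) * ((N r \<omega> + m r) * (\<Prod>i\<in>I - {p} - {r}. N i \<omega> + m i))"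
      using I by (subst prod.remove[of _ p], simp, simp, subst prod.remove[of _ r], auto)
    moreover have "(\<Prod>i\<in>I - {p} - {r}. N i \<omega> + m i) > 0"
      using pos by (intro prod_pos) auto
    ultimately have "(N p \<omega> + m p) * (N r \<omega> + m r) \<le> (\<Prod>i\<in>I. N i \<omega> + m i)"
      by simp
    then have "f \<omega> \<le> c ^ ((N p \<omega> + m p) * (N r \<omega> + m r))"
      unfolding f_def using c by (intro power_decreasing) auto
    also have "\<dots> \<le> B \<omega>"
      unfolding B_def using c pos I by (intro power_mult_le) auto
    finally show ?thesis
      using g0 c by (simp add: f_def)
  qed
  show "A \<le> E"
    unfolding E_def g(2)[symmetric] f_def[symmetric]
    using bounds by (intro integral_mono g f_int) auto
  have "E \<le> expectation (\<lambda>\<omega>. g \<omega> + B \<omega>)"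
    unfolding E_def f_def[symmetric]
    using bounds by (intro integral_mono g f_int Bochner_Integration.integrable_add B) auto
  also have "\<dots> = A + (256 ^ J * exp (- 3 / 2 * \<mu>) + c ^ J * (2 * exp (- \<mu> * (1 - c ^ J))))"
    using g B by simp
  finally show "E \<le> A + (256 ^ J * exp (- 3 / 2 * \<mu>) + c ^ J * (2 * exp (- \<mu> * (1 - c ^ J))))" .
qed

text \<open>After multiplication by \<open>exp (a * \<tau>)\<close> the lower bound tends to the
  number of indices with \<open>m i = 0\<close>, and the error tends to 0 once \<open>J\<close>
  grows like the square root of the Poisson parameter.\<close>

lemma tendsto_expectation_exp_prod_poisson:
  fixes W :: "real \<Rightarrow> 'w measure" and N :: "real \<Rightarrow> 'i \<Rightarrow> 'w \<Rightarrow> nat"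
  assumes I: "finite I" "p \<in> I" "r \<in> I" "p \<noteq> r"
    and W: "\<And>a. a \<ge> 1 \<Longrightarrow> prob_space (W a)"
    and indep: "\<And>a. a \<ge> 1 \<Longrightarrow> prob_space.indep_vars (W a) (\<lambda>_. count_space UNIV) (N a) I"
    and prob: "\<And>a i n. a \<ge> 1 \<Longrightarrow> i \<in> I \<Longrightarrow>
      measure (W a) {\<omega> \<in> space (W a). N a i \<omega> = n} = (a * \<tau>) ^ n / fact n * exp (- (a * \<tau>))"
    and \<tau>: "\<tau> > 0" and \<nu>: "\<nu> < 0"
  shows "((\<lambda>a. (LINT \<omega>|W a. exp (\<nu> * real (\<Prod>i\<in>I. N a i \<omega> + m i))) * exp (a * \<tau>))
    \<longlongrightarrow> real (card {i\<in>I. m i = 0})) at_top"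
proof -
  let ?z = "card {i\<in>I. m i = 0}"
  define E where "E a = (LINT \<omega>|W a. exp \<nu> ^ (\<Prod>i\<in>I. N a i \<omega> + m i))" for a
  define A where "A a = 1 - (1 - exp (- (a * \<tau>))) ^ ?z" for a
  \<comment> \<open>A compromise: slow enough that \<open>256 ^ J a\<close> is negligible against
    \<open>exp (a * \<tau> / 2)\<close>, fast enough that
    \<open>a * \<tau> * exp \<nu> ^ J a\<close> tends to 0.\<close>
  define J where "J a = nat \<lfloor>sqrt (a * \<tau>)\<rfloor>" for a
  \<comment> \<open>Rounding down loses less than 1, hence the shift; this bounds
    \<open>exp \<nu> ^ J a\<close> from above because \<open>\<nu> < 0\<close>.\<close>
  define w where "w a = exp (\<nu> * (sqrt (a * \<tau>) - 1))" for a
  define U where "U a = 256 powr sqrt (a * \<tau>) * exp (- 1 / 2 * (a * \<tau>)) + w a * (2 * exp (a * \<tau> * w a))" for a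
  have A_lim: "((\<lambda>a. A a * exp (a * \<tau>)) \<longlongrightarrow> real ?z) at_top"
  proof -
    have "((\<lambda>a. \<Sum>i<?z. (1 - exp (- (a * \<tau>))) ^ i) \<longlongrightarrow> (\<Sum>i<?z. (1 - 0) ^ i)) at_top"
      using \<tau> by (intro tendsto_intros) real_asymp
    \<comment> \<open>A finite geometric sum: with \<open>q = exp (- (a * \<tau>))\<close> it is
      \<open>1 - (1 - q) ^ ?z\<close> divided by \<open>q\<close>, and each summand tends to
      1.\<close>
    moreover have "A a * exp (a * \<tau>) = (\<Sum>i<?z. (1 - exp (- (a * \<tau>))) ^ i)" for a
      unfolding A_def by (subst one_diff_power_eq) (simp add: exp_minus)
    ultimately show ?thesis
      by simp
  qed
  have U_lim: "(U \<longlongrightarrow> 0) at_top"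
  proof -
    \<comment> \<open>Here \<open>x\<close> stands for \<open>sqrt (a * \<tau>)\<close>, which is
      substituted back by \<open>filterlim_compose\<close>.\<close>
    have "((\<lambda>x::real. 256 powr x * exp (- 1/2 * x\<^sup>2)) \<longlongrightarrow> 0) at_top"
      by real_asymp
    moreover have "((\<lambda>x::real. exp (\<nu> * (x - 1)) * (2 * exp (x\<^sup>2 * exp (\<nu> * (x - 1))))) \<longlongrightarrow> 0) at_top"
      using \<nu> by real_asymp
    ultimately have "((\<lambda>x::real. 256 powr x * exp (- 1/2 * x\<^sup>2)
        + exp (\<nu> * (x - 1)) * (2 * exp (x\<^sup>2 * exp (\<nu> * (x - 1))))) \<longlongrightarrow> 0 + 0) at_top"
      by (rule tendsto_add)
    moreover have "filterlim (\<lambda>a. sqrt (a * \<tau>)) at_top at_top"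
      using \<tau> by real_asymp
    ultimately have "((\<lambda>a. 256 powr sqrt (a * \<tau>) * exp (- 1/2 * (sqrt (a * \<tau>))\<^sup>2)
        + exp (\<nu> * (sqrt (a * \<tau>) - 1)) *
          (2 * exp ((sqrt (a * \<tau>))\<^sup>2 * exp (\<nu> * (sqrt (a * \<tau>) - 1))))) \<longlongrightarrow> 0 + 0) at_top"
      by (rule filterlim_compose)
    moreover have "\<forall>\<^sub>F a in at_top. 256 powr sqrt (a * \<tau>) * exp (- 1/2 * (sqrt (a * \<tau>))\<^sup>2)
        + exp (\<nu> * (sqrt (a * \<tau>) - 1)) *
          (2 * exp ((sqrt (a * \<tau>))\<^sup>2 * exp (\<nu> * (sqrt (a * \<tau>) - 1)))) = U a"
      using eventually_ge_at_top[of 0] by eventually_elim (use \<tau> in \<open>simp add: U_def w_def\<close>)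
    ultimately show ?thesis
      by (simp add: filterlim_cong[OF refl refl])
  qed
  have bounds: "A a * exp (a * \<tau>) \<le> E a * exp (a * \<tau>) \<and>
      E a * exp (a * \<tau>) \<le> A a * exp (a * \<tau>) + U a" if a: "a \<ge> 1" for a
  proof -
    interpret prob_space "W a" by (rule W[OF a])
    have pos: "a * \<tau> > 0"
      using a \<tau> by simp
    have J: "sqrt (a * \<tau>) - 1 \<le> real (J a)" "real (J a) \<le> sqrt (a * \<tau>)"
    proof -
      have "real (J a) = of_int \<lfloor>sqrt (a * \<tau>)\<rfloor>"
        using pos by (simp add: J_def)
      then show "sqrt (a * \<tau>) - 1 \<le> real (J a)" "real (J a) \<le> sqrt (a * \<tau>)"
        by linarith+
    qed
    have J1: "256 ^ J a \<le> (256::real) powr sqrt (a * \<tau>)"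
      using J by (simp add: powr_realpow[symmetric])
    have J2: "exp \<nu> ^ J a \<le> w a"
      using J \<nu> by (simp add: exp_of_nat_mult[symmetric] w_def mult.commute)
    note bd = expectation_power_prod_poisson_bounds[OF I indep[OF a] prob[OF a] pos, of "exp \<nu>" m]
    have lower: "A a \<le> E a"
      unfolding A_def E_def using bd(1) \<nu> by simp
    have "E a \<le> A a + (256 ^ J a * exp (- 3 / 2 * (a * \<tau>))
        + exp \<nu> ^ J a * (2 * exp (- (a * \<tau>) * (1 - exp \<nu> ^ J a))))"
      unfolding A_def E_def using bd(2) \<nu> by simp
    then have "E a * exp (a * \<tau>) \<le> (A a + (256 ^ J a * exp (- 3 / 2 * (a * \<tau>))
        + exp \<nu> ^ J a * (2 * exp (- (a * \<tau>) * (1 - exp \<nu> ^ J a))))) * exp (a * \<tau>)"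
      by (rule mult_right_mono) simp
    also have "\<dots> = A a * exp (a * \<tau>) + (256 ^ J a * (exp (- 3 / 2 * (a * \<tau>)) * exp (a * \<tau>))
        + exp \<nu> ^ J a * (2 * (exp (- (a * \<tau>) * (1 - exp \<nu> ^ J a)) * exp (a * \<tau>))))"
      by (simp add: algebra_simps)
    \<comment> \<open>In units of \<open>a * \<tau>\<close> the exponents combine to
      \<open>- 3/2 + 1 = - 1/2\<close> and \<open>- (1 - c ^ J a) + 1 = c ^ J a\<close>, with
      \<open>c = exp \<nu>\<close>.\<close>
    also have "\<dots> = A a * exp (a * \<tau>) + (256 ^ J a * exp (- 1 / 2 * (a * \<tau>))
        + exp \<nu> ^ J a * (2 * exp (a * \<tau> * exp \<nu> ^ J a)))"
      unfolding exp_add[symmetric] by (simp add: algebra_simps)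
    also have "\<dots> \<le> A a * exp (a * \<tau>) + U a"
      unfolding U_def using J1 J2 pos
      by (intro add_left_mono add_mono mult_mono) (auto simp: w_def intro!: mult_left_mono)
    finally show ?thesis
      using lower by simp
  qed
  have "((\<lambda>a. E a * exp (a * \<tau>)) \<longlongrightarrow> real ?z) at_top"
  proof (rule tendsto_sandwich)
    show "\<forall>\<^sub>F a in at_top. A a * exp (a * \<tau>) \<le> E a * exp (a * \<tau>)"
      "\<forall>\<^sub>F a in at_top. E a * exp (a * \<tau>) \<le> A a * exp (a * \<tau>) + U a"
      using bounds
      by (blast intro: eventually_mono[OF eventually_ge_at_top[of 1]])+
    show "((\<lambda>a. A a * exp (a * \<tau>) + U a) \<longlongrightarrow> real ?z) at_top"
      using tendsto_add[OF A_lim U_lim] by simp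
  qed (rule A_lim)
  moreover have "exp (\<nu> * real n) = exp \<nu> ^ n" for n
    by (simp add: exp_of_nat_mult[symmetric] mult.commute)
  ultimately show ?thesis
    by (simp only: E_def)
qed

section \<open>The intensity measure and counts by orientation\<close>

lemma sets_cube: "cube b \<in> sets (borel :: (real^'d::finite) measure)"
proof -
  have "cube b = (cbox 0 (\<chi> i. b) :: (real^'d) set)"
    by (auto simp: cube_def mem_box_cart)
  then show ?thesis by simp
qed

lemma prob_space_mark:
  "prob_space (return (count_space {2 * b}) (2 * b) \<Otimes>\<^sub>M
    uniform_count_measure (unit_vectors :: (real^'d::finite) set))"
proof -
  have "prob_space (return (count_space {2 * b}) (2 * b))"
    by (rule prob_space_return) simp
  moreover have "prob_space (uniform_count_measure (unit_vectors :: (real^'d) set))"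
    by (rule prob_space_uniform_count_measure) (auto simp: unit_vectors_def)
  ultimately show ?thesis
    by (rule prob_space_pair)
qed

lemma space_facet_measure: "space (facet_measure b h) = facet_params b"
  by (simp add: facet_measure_def facet_params_def space_pair_measure space_restrict_space
      space_uniform_count_measure)

text \<open>The mark has mass \<open>1 / CARD('d)\<close> on each orientation, independently of the
  position. The position set \<open>A\<close> is kept general as both the whole cube and single
  points are needed.\<close>

lemma
  fixes h :: "real^'d::finite \<Rightarrow> real"
  assumes h: "h \<in> borel_measurable (restrict_space borel (cube b))"
    and A: "A \<in> sets borel" "A \<subseteq> cube b"
  shows sets_facet_measure_Times: "A \<times> {2 * b} \<times> {axis i 1} \<in> sets (facet_measure b h)"
    and emeasure_facet_measure_Times: "emeasure (facet_measure b h) (A \<times> {2 * b} \<times> {axis i 1})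
      = (\<integral>\<^sup>+z\<in>A. ennreal (h z) \<partial>lborel) * ennreal (1 / CARD('d))"
proof -
  let ?R = "restrict_space lborel (cube b) :: (real^'d) measure"
  let ?M1 = "density ?R (\<lambda>z. ennreal (h z))"
  let ?M2 = "return (count_space {2 * b}) (2 * b)"
  let ?M3 = "uniform_count_measure (unit_vectors :: (real^'d) set)"
  have h': "h \<in> borel_measurable ?R"
    using h by (simp cong: measurable_cong_sets sets_restrict_space_cong)
  have AR: "A \<in> sets ?R"
    using A sets_cube[of b] by (subst sets_restrict_space_iff) auto
  have card: "card (unit_vectors :: (real^'d) set) = CARD('d)"
    unfolding unit_vectors_def by (rule card_image) (auto simp: inj_def)
  have fin: "finite (unit_vectors :: (real^'d) set)"
    by (auto simp: unit_vectors_def)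
  have u: "{axis i 1} \<in> sets ?M3" "emeasure ?M3 {axis i 1} = ennreal (1 / CARD('d))"
    using fin card by (auto simp: unit_vectors_def sets_uniform_count_measure emeasure_uniform_count_measure)
  have b2: "{2 * b} \<in> sets ?M2" "emeasure ?M2 {2 * b} = 1"
    by (auto simp: emeasure_return)
  interpret M23: prob_space "?M2 \<Otimes>\<^sub>M ?M3"
    by (rule prob_space_mark)
  interpret M3: prob_space ?M3
    by (rule prob_space_uniform_count_measure) (auto simp: unit_vectors_def)
  have m23: "{2 * b} \<times> {axis i 1} \<in> sets (?M2 \<Otimes>\<^sub>M ?M3)"
    using b2 u by (intro pair_measureI)
  show "A \<times> {2 * b} \<times> {axis i 1} \<in> sets (facet_measure b h)"
    unfolding facet_measure_def using AR by (intro pair_measureI m23) simp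
  have "emeasure (facet_measure b h) (A \<times> {2 * b} \<times> {axis i 1})
      = emeasure ?M1 A * emeasure (?M2 \<Otimes>\<^sub>M ?M3) ({2 * b} \<times> {axis i 1})"
    unfolding facet_measure_def using AR by (intro M23.emeasure_pair_measure_Times m23) simp
  also have "emeasure (?M2 \<Otimes>\<^sub>M ?M3) ({2 * b} \<times> {axis i 1}) = ennreal (1 / CARD('d))"
    by (simp only: M3.emeasure_pair_measure_Times[OF b2(1) u(1)] b2(2) u(2) mult_1)
  also have "emeasure ?M1 A = (\<integral>\<^sup>+z\<in>A. ennreal (h z) \<partial>?R)"
    using h' AR by (intro emeasure_density) auto
  also have "\<dots> = (\<integral>\<^sup>+z. (ennreal (h z) * indicator A z) * indicator (cube b) z \<partial>lborel)"
    using sets_cube by (subst nn_integral_restrict_space) auto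
  also have "\<dots> = (\<integral>\<^sup>+z\<in>A. ennreal (h z) \<partial>lborel)"
    using A by (intro nn_integral_cong) (auto simp: indicator_def)
  finally show "emeasure (facet_measure b h) (A \<times> {2 * b} \<times> {axis i 1})
      = (\<integral>\<^sup>+z\<in>A. ennreal (h z) \<partial>lborel) * ennreal (1 / CARD('d))" .
qed

text \<open>The uniform marks give each orientation the same share of the total mass, and
  \<open>Y\<close> is null because a single position has Lebesgue measure 0.\<close>

lemma
  fixes h :: "real^'d::finite \<Rightarrow> real" and i :: 'd and b :: real
  defines "D \<equiv> {y \<in> facet_params b. orientation y = axis i 1}"
  assumes h: "h \<in> borel_measurable (restrict_space borel (cube b))"
    and nonneg: "\<And>z. z \<in> cube b \<Longrightarrow> 0 \<le> h z"
    and T: "(LINT z:cube b|lborel. h z) > 0"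
    and Y: "finite Y" "Y \<subseteq> facet_params b"
  shows sets_facets_orientation_diff: "D - Y \<in> sets (facet_measure b h)"
    and measure_facets_orientation_diff:
      "measure (facet_measure b h) (D - Y) = (LINT z:cube b|lborel. h z) / CARD('d)"
proof -
  let ?M = "facet_measure b h"
  have D: "D = cube b \<times> {2 * b} \<times> {axis i 1}"
    by (auto simp: D_def facet_params_def orientation_def unit_vectors_def)
  note C = sets_cube[of b, where 'd = 'd]
  have sD: "D \<in> sets ?M"
    unfolding D using sets_facet_measure_Times[OF h C] by simp
  have sing: "{y} \<in> null_sets ?M" if "y \<in> facet_params b" for y
  proof -
    obtain z j where y: "y = (z, 2 * b, axis j 1)" "z \<in> cube b"
      using \<open>y \<in> facet_params b\<close> by (rule facet_params_memD)
    have eq: "{y} = {z} \<times> {2 * b} \<times> {axis j 1}"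
      using y by simp
    have "(\<integral>\<^sup>+z'\<in>{z}. ennreal (h z') \<partial>lborel) = 0"
      by (rule nn_integral_null_set) (auto simp: null_sets_def)
    then have "emeasure ?M ({z} \<times> {2 * b} \<times> {axis j 1}) = 0"
      by (subst emeasure_facet_measure_Times[OF h]) (use y in auto)
    then show ?thesis
      unfolding eq using y by (intro null_setsI sets_facet_measure_Times[OF h]) auto
  qed
  have "(\<Union>y\<in>Y. {y}) \<in> null_sets ?M"
    using Y by (intro null_sets_UN') (auto intro: countable_finite sing)
  then have nY: "Y \<in> null_sets ?M"
    by simp
  then show "D - Y \<in> sets ?M"
    using sD by auto
  \<comment> \<open>Non-integrable functions have integral 0 by convention, so a positive integral
    forces integrability.\<close>
  have int: "set_integrable lborel (cube b) h"
    using T not_integrable_integral_eq unfolding set_integrable_def set_lebesgue_integral_def by force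
  have "(\<integral>\<^sup>+z\<in>cube b. ennreal (h z) \<partial>lborel) = (\<integral>\<^sup>+z. ennreal (indicator (cube b) z *\<^sub>R h z) \<partial>lborel)"
    by (intro nn_integral_cong) (auto simp: indicator_def)
  also have "\<dots> = ennreal (LINT z:cube b|lborel. h z)"
    unfolding set_lebesgue_integral_def using int nonneg
    by (intro nn_integral_eq_integral) (auto simp: set_integrable_def indicator_def)
  finally have "emeasure ?M D = ennreal (LINT z:cube b|lborel. h z) * ennreal (1 / CARD('d))"
    unfolding D by (subst emeasure_facet_measure_Times[OF h C]) auto
  then have "emeasure ?M D = ennreal ((LINT z:cube b|lborel. h z) / CARD('d))"
    using T by (simp add: ennreal_mult[symmetric])
  moreover have "emeasure ?M (D - Y) = emeasure ?M D"
    using sD nY by (rule emeasure_Diff_null_set[rotated])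
  ultimately show "measure ?M (D - Y) = (LINT z:cube b|lborel. h z) / CARD('d)"
    using T by (simp add: measure_def)
qed

text \<open>Removing \<open>Y\<close> from the sets on which points are counted makes the contributions of
  \<open>\<eta>\<close> and \<open>Y\<close> add up for every outcome rather than almost surely, and does not change the
  intensity, as \<open>Y\<close> is a null set.\<close>
lemma facet_G_union_eq_prod:
  fixes x Y :: "'d::finite facet_param set"
  assumes x: "finite x" "x \<subseteq> facet_params b" and Y: "finite Y" "Y \<subseteq> facet_params b"
  shows "facet_G CARD('d) (x \<union> Y) = real (\<Prod>i\<in>UNIV.
    card (x \<inter> ({y \<in> facet_params b. orientation y = axis i 1} - Y)) + card {y\<in>Y. orientation y = axis i 1})"
proof -
  have "card {y \<in> x \<union> Y. orientation y = axis i 1} =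
    card (x \<inter> ({y \<in> facet_params b. orientation y = axis i 1} - Y)) + card {y\<in>Y. orientation y = axis i 1}"
    for i
  proof -
    have "{y \<in> x \<union> Y. orientation y = axis i 1} =
      (x \<inter> ({y \<in> facet_params b. orientation y = axis i 1} - Y)) \<union> {y\<in>Y. orientation y = axis i 1}"
      using x Y by auto
    then show ?thesis
      using x Y by (simp, subst card_Un_disjoint) auto
  qed
  then show ?thesis
    using facet_G_top_eq_prod[of "x \<union> Y" b] x Y by simp
qed

section \<open>Limits of the expectations and of the correlation functions\<close>

text \<open>The counts on the disjoint sets \<open>D i\<close> are independent and Poisson with
  parameter \<open>a * \<tau>\<close>, so the limit for products applies; the orientations missing
  from \<open>Y\<close> are exactly those with \<open>m i = 0\<close>.\<close>

lemma tendsto_expectation_exp_facet_G: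
  fixes h :: "real^'d::finite \<Rightarrow> real" and \<eta> :: "real \<Rightarrow> 'w \<Rightarrow> 'd facet_param set"
  assumes h: "h \<in> borel_measurable (restrict_space borel (cube b))"
    and nonneg: "\<And>z. z \<in> cube b \<Longrightarrow> 0 \<le> h z"
    and T: "(LINT z:cube b|lborel. h z) > 0"
    and poisson: "\<And>a. a \<ge> 1 \<Longrightarrow>
      poisson_process (W a) (scale_measure (ennreal a) (facet_measure b h)) (\<eta> a)"
    and dim: "CARD('d) \<ge> 2" and \<nu>: "\<nu> < 0"
    and Y: "finite Y" "Y \<subseteq> facet_params b"
  defines "\<tau> \<equiv> (LINT z:cube b|lborel. h z) / CARD('d)"
  shows "((\<lambda>a. (LINT \<omega>|W a. exp (\<nu> * facet_G CARD('d) (\<eta> a \<omega> \<union> Y))) * exp (a * \<tau>))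
    \<longlongrightarrow> real (CARD('d) - card (orientation ` Y))) at_top"
proof -
  define D where "D i = {y \<in> facet_params b. orientation y = axis i 1} - Y" for i :: 'd
  define m where "m i = card {y\<in>Y. orientation y = axis i 1}" for i :: 'd
  \<comment> \<open>The independence clause of \<open>poisson_process\<close> is indexed by natural
    numbers, so the coordinates are enumerated.\<close>
  obtain g :: "nat \<Rightarrow> 'd" where g: "bij_betw g {..<CARD('d)} UNIV"
    using bij_betw_from_nat_into_finite ex_bij_betw_nat_finite[of "UNIV :: 'd set"]
    by (auto simp: atLeast0LessThan)
  have D: "D i \<in> sets (facet_measure b h)" "measure (facet_measure b h) (D i) = \<tau>" for i
    unfolding D_def \<tau>_def
    using sets_facets_orientation_diff[OF h nonneg T Y] measure_facets_orientation_diff[OF h nonneg T Y]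
    by auto
  have disj: "disjoint_family_on (\<lambda>j. D (g j)) {..<CARD('d)}"
    using g by (auto simp: disjoint_family_on_def D_def bij_betw_def inj_on_def)
  have lim: "((\<lambda>a. (LINT \<omega>|W a. exp (\<nu> * real (\<Prod>j<CARD('d). card (\<eta> a \<omega> \<inter> D (g j)) + m (g j)))) * exp (a * \<tau>))
    \<longlongrightarrow> real (card {j\<in>{..<CARD('d)}. m (g j) = 0})) at_top"
  \<comment> \<open>The indices 0 and 1 serve as the two distinct factors; both lie in the range as
    \<open>CARD('d) \<ge> 2\<close>.\<close>
  proof (rule tendsto_expectation_exp_prod_poisson[of _ 0 1])
    fix a :: real assume a: "a \<ge> 1"
    note P = poisson[OF a, unfolded poisson_process_def]
    show "prob_space (W a)"
      using P by blast
    show "prob_space.indep_vars (W a) (\<lambda>_. count_space UNIV) (\<lambda>j \<omega>. card (\<eta> a \<omega> \<inter> D (g j))) {..<CARD('d)}"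
      using P disj D by simp
    fix j n
    have "measure (W a) {\<omega> \<in> space (W a). card (\<eta> a \<omega> \<inter> D (g j)) = n} =
      measure (scale_measure (ennreal a) (facet_measure b h)) (D (g j)) ^ n / fact n *
      exp (- measure (scale_measure (ennreal a) (facet_measure b h)) (D (g j)))"
      using P D by simp
    also have "measure (scale_measure (ennreal a) (facet_measure b h)) (D (g j)) = a * \<tau>"
      using a D by (simp add: measure_scale_measure)
    finally show "measure (W a) {\<omega> \<in> space (W a). card (\<eta> a \<omega> \<inter> D (g j)) = n} =
      (a * \<tau>) ^ n / fact n * exp (- (a * \<tau>))" .
  qed (use dim T \<nu> in \<open>auto simp: \<tau>_def\<close>)
  have card: "card {j\<in>{..<CARD('d)}. m (g j) = 0} = CARD('d) - card (orientation ` Y)"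
  proof -
    have m0: "m i = 0 \<longleftrightarrow> {y\<in>Y. orientation y = axis i 1} = {}" for i
      using Y by (simp add: m_def)
    have "bij_betw g {j\<in>{..<CARD('d)}. m (g j) = 0} {i. m i = 0}"
      using g by (auto simp: bij_betw_def inj_on_def image_iff)
    then have "card {j\<in>{..<CARD('d)}. m (g j) = 0} = card {i. m i = 0}"
      by (rule bij_betw_same_card)
    also have "{i. m i = 0} = - {i. axis i 1 \<in> orientation ` Y}"
      using m0 by (force simp del: split_paired_All split_paired_Ex)
    also have "card \<dots> = CARD('d) - card {i. axis i 1 \<in> orientation ` Y}"
      by (simp add: Compl_eq_Diff_UNIV card_Diff_subset)
    also have "card {i. axis i 1 \<in> orientation ` Y} =
      card ((\<lambda>i. axis i (1::real)) ` {i. axis i 1 \<in> orientation ` Y})"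
      by (rule card_image[symmetric]) (auto simp: inj_on_def)
    also have "(\<lambda>i. axis i 1) ` {i. axis i 1 \<in> orientation ` Y} = orientation ` Y"
      using Y by (force simp: facet_params_def orientation_def unit_vectors_def)
    finally show ?thesis by simp
  qed
  \<comment> \<open>The process is specified only for \<open>a \<ge> 1\<close>, where its values are
    finite sets of facets; so the equality is stated eventually.\<close>
  have ev: "\<forall>\<^sub>F a in at_top.
    (LINT \<omega>|W a. exp (\<nu> * real (\<Prod>j<CARD('d). card (\<eta> a \<omega> \<inter> D (g j)) + m (g j)))) * exp (a * \<tau>) =
    (LINT \<omega>|W a. exp (\<nu> * facet_G CARD('d) (\<eta> a \<omega> \<union> Y))) * exp (a * \<tau>)"
    using eventually_ge_at_top[of 1]
  proof eventually_elim
    case (elim a)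
    have "facet_G CARD('d) (\<eta> a \<omega> \<union> Y) = real (\<Prod>j<CARD('d). card (\<eta> a \<omega> \<inter> D (g j)) + m (g j))"
      if "\<omega> \<in> space (W a)" for \<omega>
    proof -
      have "\<eta> a \<in> measurable (W a) (config_space (scale_measure (ennreal a) (facet_measure b h)))"
        using poisson[OF elim] by (simp add: poisson_process_def)
      from measurable_space[OF this that] have "finite (\<eta> a \<omega>)" "\<eta> a \<omega> \<subseteq> facet_params b"
        by (auto simp: config_space_def configurations_def space_measure_of_conv space_scale_measure
            space_facet_measure)
      from facet_G_union_eq_prod[OF this Y]
      show ?thesis
        by (simp only: prod.reindex_bij_betw[OF g, symmetric] D_def m_def)
    qed
    then show ?case
      by (intro arg_cong2[where f = "(*)"] Bochner_Integration.integral_cong) auto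
  qed
  show ?thesis
    using Lim_transform_eventually[OF lim ev] by (simp only: card)
qed

text \<open>The normalizing constant makes the correlation function a quotient of two expectations,
  with the given points and with none added. The same exponential factor gives both a finite limit,
  the lower one being \<open>CARD('d)\<close>, and cancels.\<close>

lemma tendsto_correlation:
  fixes h :: "real^'d::finite \<Rightarrow> real" and \<eta> :: "real \<Rightarrow> 'w \<Rightarrow> 'd facet_param set"
  assumes h: "h \<in> borel_measurable (restrict_space borel (cube b))"
    and nonneg: "\<And>z. z \<in> cube b \<Longrightarrow> 0 \<le> h z"
    and T: "(LINT z:cube b|lborel. h z) > 0"
    and poisson: "\<And>a. a \<ge> 1 \<Longrightarrow>
      poisson_process (W a) (scale_measure (ennreal a) (facet_measure b h)) (\<eta> a)"
    and dim: "CARD('d) \<ge> 2" and \<nu>: "\<nu> < 0"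
    and y: "y ` {1..n} \<subseteq> facet_params b"
  shows "((\<lambda>a. correlation (W a) (\<eta> a) \<nu> n y) \<longlongrightarrow>
    (real CARD('d) - real (card ((\<lambda>i. orientation (y i)) ` {1..n}))) / real CARD('d)) at_top"
proof -
  let ?\<tau> = "(LINT z:cube b|lborel. h z) / CARD('d)"
  let ?E = "\<lambda>Y a. LINT \<omega>|W a. exp (\<nu> * facet_G CARD('d) (\<eta> a \<omega> \<union> Y))"
  note lim = tendsto_expectation_exp_facet_G[OF h nonneg T poisson dim \<nu>]
  have "((\<lambda>a. (?E (y ` {1..n}) a * exp (a * ?\<tau>)) / (?E {} a * exp (a * ?\<tau>))) \<longlongrightarrow>
    real (CARD('d) - card (orientation ` y ` {1..n})) / real (CARD('d) - card (orientation ` ({} :: 'd facet_param set)))) at_top"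
  proof (rule tendsto_divide)
    show "((\<lambda>a. ?E (y ` {1..n}) a * exp (a * ?\<tau>)) \<longlongrightarrow>
      real (CARD('d) - card (orientation ` y ` {1..n}))) at_top"
      by (rule lim) (use y in auto)
    show "((\<lambda>a. ?E {} a * exp (a * ?\<tau>)) \<longlongrightarrow>
      real (CARD('d) - card (orientation ` ({} :: 'd facet_param set)))) at_top"
      by (rule lim) auto
  qed simp
  moreover have "(?E (y ` {1..n}) a * exp (a * ?\<tau>)) / (?E {} a * exp (a * ?\<tau>)) =
    correlation (W a) (\<eta> a) \<nu> n y" for a
    by (simp add: correlation_def facet_density_def normalizing_constant_def)
  \<comment> \<open>This bound turns the truncated subtraction of naturals into the real
    difference.\<close>
  moreover have "card (orientation ` y ` {1..n}) \<le> CARD('d)"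
  proof -
    have "orientation ` y ` {1..n} \<subseteq> range (\<lambda>i. axis i 1)"
      using y by (force simp: facet_params_def orientation_def unit_vectors_def)
    then have "card (orientation ` y ` {1..n}) \<le> card (range (\<lambda>i::'d. axis i (1::real)))"
      by (intro card_mono) auto
    also have "\<dots> \<le> CARD('d)"
      by (rule card_image_le) simp
    finally show ?thesis .
  qed
  ultimately show ?thesis
    by (simp add: image_image)
qed

section \<open>Counting the orientations in the three cases\<close>

theorem proposition3:
  fixes b \<nu> :: real
    and h :: "real^'d::finite \<Rightarrow> real"
    and W :: "real \<Rightarrow> 'w measure"
    and \<eta> :: "real \<Rightarrow> 'w \<Rightarrow> 'd facet_param set"
    and lab :: "nat \<Rightarrow> 'd"
    and e :: "nat \<Rightarrow> real^'d"
    and k :: nat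
  assumes b_pos: "b > 0"
    and h_measurable: "h \<in> borel_measurable (restrict_space borel (cube b))"
    and h_nonneg: "\<And>z. z \<in> cube b \<Longrightarrow> 0 \<le> h z"
    and h_bounded: "bounded (h ` cube b)"
    and T_pos: "(LINT z:cube b|lborel. h z) > 0"
    and poisson: "\<And>a. a \<ge> 1 \<Longrightarrow>
      poisson_process (W a) (scale_measure (ennreal a) (facet_measure b h)) (\<eta> a)"
    and lab: "bij_betw lab {1..CARD('d)} (UNIV :: 'd set)"
    and e: "\<And>j. e j = axis (lab j) 1"
    and dim: "CARD('d) \<ge> 3"
    and nu_neg: "\<nu> < 0"
    and k: "1 \<le> k" "k \<le> CARD('d) - 1"
  shows
    "(\<forall>y. y ` {1..CARD('d) - k} \<subseteq> facet_params b \<and>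
        inj_on (\<lambda>i. orientation (y i)) {1..CARD('d) - k} \<longrightarrow>
        ((\<lambda>a. correlation (W a) (\<eta> a) \<nu> (CARD('d) - k) y)
           \<longlongrightarrow> real k / real CARD('d)) at_top)
     \<and>
     (\<forall>y l. y ` {1..2 * (CARD('d) - k)} \<subseteq> facet_params b \<and>
        inj_on y {1..2 * (CARD('d) - k)} \<and>
        inj_on (\<lambda>i. orientation (y i)) {1..CARD('d) - k} \<and>
        inj_on (\<lambda>i. orientation (y i)) {CARD('d) - k + 1..2 * (CARD('d) - k)} \<and>
        card ((\<lambda>i. orientation (y i)) ` {1..CARD('d) - k} \<inter>
              (\<lambda>i. orientation (y i)) ` {CARD('d) - k + 1..2 * (CARD('d) - k)}) = l \<longrightarrow>
        ((\<lambda>a. correlation (W a) (\<eta> a) \<nu> (2 * (CARD('d) - k)) y)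
           \<longlongrightarrow> (2 * real k - real CARD('d) + real l) / real CARD('d)) at_top)
     \<and>
     (\<forall>y l. y ` {1..2 * (CARD('d) - k) - 1} \<subseteq> facet_params b \<and>
        inj_on y {1..2 * (CARD('d) - k) - 1} \<and>
        inj_on (\<lambda>i. orientation (y i)) {1..CARD('d) - k} \<and>
        inj_on (\<lambda>i. orientation (y i)) ({CARD('d) - k + 1..2 * (CARD('d) - k) - 1} \<union> {1}) \<and>
        orientation (y 1) = e 1 \<and>
        l + 1 \<le> CARD('d) \<and>
        ((\<lambda>i. orientation (y i)) ` {1..CARD('d) - k} \<inter>
         (\<lambda>i. orientation (y i)) ` ({CARD('d) - k + 1..2 * (CARD('d) - k) - 1} \<union> {1})) - {e 1}
          = e ` {2..l + 1} \<longrightarrow>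
        ((\<lambda>a. correlation (W a) (\<eta> a) \<nu> (2 * (CARD('d) - k) - 1) y)
           \<longlongrightarrow> (2 * real k - real CARD('d) + real l + 1) / real CARD('d)) at_top)"
proof (intro conjI allI impI, goal_cases)
  have dim2: "CARD('d) \<ge> 2"
    using dim by simp
  note lim = tendsto_correlation[OF h_measurable h_nonneg T_pos poisson dim2 nu_neg]
  \<comment> \<open>The size of each group. The orientations that occur number \<open>n\<close>,
    \<open>2 * n - l\<close> and \<open>2 * n - (l + 1)\<close> in the three cases.\<close>
  define n where "n = CARD('d) - k"
  have n: "n \<ge> 1" "real n = real CARD('d) - real k"
    using k by (auto simp: n_def)
  {
    case (1 y)
    then have "card ((\<lambda>i. orientation (y i)) ` {1..n}) = n"
      by (simp add: card_image n_def)
    with lim[of y n] 1 n show ?case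
      by (simp add: n_def)
  next
    case (2 y l)
    let ?o = "\<lambda>i. orientation (y i)"
    let ?A = "?o ` {1..n}" and ?B = "?o ` {n + 1..2 * n}"
    have AB: "card ?A = n" "card ?B = n" "card (?A \<inter> ?B) = l"
      using 2 by (simp_all add: card_image n_def)
    have "{1..2 * n} = {1..n} \<union> {n + 1..2 * n}"
      by auto
    then have "?o ` {1..2 * n} = ?A \<union> ?B"
      by (simp only: image_Un)
    moreover have "card ?A + card ?B = card (?A \<union> ?B) + card (?A \<inter> ?B)"
      by (rule card_Un_Int) auto
    ultimately have "n + n = card (?o ` {1..2 * n}) + l"
      using AB by (simp only:)
    then have "real n + real n = real (card (?o ` {1..2 * n})) + real l"
      by (simp only: of_nat_add[symmetric])
    then have "real CARD('d) - real (card (?o ` {1..2 * n})) = 2 * real k - real CARD('d) + real l"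
      using n by simp
    moreover have "y ` {1..2 * n} \<subseteq> facet_params b"
      using 2 by (simp only: n_def)
    ultimately show ?case
      using lim[of y "2 * n"] by (simp only: n_def)
  next
    case (3 y l)
    let ?o = "\<lambda>i. orientation (y i)"
    let ?A = "?o ` {1..n}" and ?B = "?o ` ({n + 1..2 * n - 1} \<union> {1})"
    \<comment> \<open>The facet \<open>y 1\<close> belongs to both groups: the interval contributes
      \<open>n - 1\<close> indices and the index 1 completes the second group.\<close>
    have card_group: "card ({n + 1..2 * n - 1} \<union> {1}) = n"
      using n by (subst card_Un_disjoint) auto
    have AB: "card ?A = n" "card ?B = n"
      using 3 card_group by (simp_all only: card_image n_def card_atLeastAtMost)
    have l: "l + 1 \<le> CARD('d)"
      using 3 by (simp only:)
    \<comment> \<open>The bound on \<open>l\<close> keeps the indices in the range where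
      \<open>lab\<close> is injective, so the listed orientations are distinct.\<close>
    have "inj_on lab {2..l + 1}"
      by (rule inj_on_subset[OF bij_betw_imp_inj_on[OF lab]]) (use l in auto)
    then have "inj_on e {2..l + 1}"
      by (simp add: inj_on_def e)
    then have "card (e ` {2..l + 1}) = l"
      by (simp add: card_image)
    moreover have "?A \<inter> ?B - {e 1} = e ` {2..l + 1}"
      using 3 by (simp only: n_def)
    ultimately have "card (?A \<inter> ?B - {e 1}) = l"
      by (simp only:)
    \<comment> \<open>The hypothesis removes \<open>e 1\<close>, which both groups share as the
      orientation of \<open>y 1\<close>; putting it back gives \<open>l + 1\<close> common
      orientations.\<close>
    moreover have "?o 1 \<in> ?A \<inter> ?B"
      using n by auto
    then have "e 1 \<in> ?A \<inter> ?B"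
      using 3 by (simp only:)
    ultimately have "card (?A \<inter> ?B) = l + 1"
      by (metis Suc_eq_plus1 card.remove finite_Int finite_imageI finite_atLeastAtMost)
    moreover have "{1..2 * n - 1} = {1..n} \<union> ({n + 1..2 * n - 1} \<union> {1})"
      using n by auto
    then have "?o ` {1..2 * n - 1} = ?A \<union> ?B"
      by (simp only: image_Un)
    moreover have "card ?A + card ?B = card (?A \<union> ?B) + card (?A \<inter> ?B)"
      by (rule card_Un_Int) auto
    ultimately have "n + n = card (?o ` {1..2 * n - 1}) + (l + 1)"
      using AB by (simp only:)
    then have "real n + real n = real (card (?o ` {1..2 * n - 1})) + real (l + 1)"
      by (simp only: of_nat_add[symmetric])
    then have "real CARD('d) - real (card (?o ` {1..2 * n - 1})) = 2 * real k - real CARD('d) + real l + 1"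
      using n by simp
    moreover have "y ` {1..2 * n - 1} \<subseteq> facet_params b"
      using 3 by (simp only: n_def)
    ultimately show ?case
      using lim[of y "2 * n - 1"] by (simp only: n_def)
  }
qed

end
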